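(* Let $0<\rho<1$ and $\mu$ satisfy $1+\rho\ge\mu>\omega-1$, and let $F'(\sigma,\rho)=\max\{\omega\rho+1-\rho,\omega(\sigma)\}$ (the exponent of the centralized running time of the algorithm for $S\times V$ reachability / $(1+\epsilon)$-approximate distances on $n$-vertex directed graphs with $m=n^{\mu}$ edges and treewidth $O(n^{\rho})$, $|S|=n^{\sigma}$) and $N(\sigma,\mu)=\min\{\omega,\mu+\sigma\}$ (the exponent of the state-of-the-art algorithm). Let $\sigma'_{thr}(\rho,\mu)=\max\{\sigma'_\mu,\rho(\omega-1)-(\mu-1)\}$. Then the range $(\sigma'_{thr}(\rho,\mu),1)$ is non-empty and for every $\sigma$ in it, $F'(\sigma,\rho)<N(\sigma,\mu)$.
   Context: $\omega(\sigma)$ is the (best known upper bound on the) exponent of multiplying an $n^{\sigma}\times n$ by an $n\times n$ matrix, convex and nondecreasing in $\sigma$; $\omega=\omega(1)$. For $\mu>\omega-1$, $\sigma'_\mu\in(0,1)$ is the value satisfying $\omega(\sigma'_\mu)=\mu+\sigma'_\mu$.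
   Formalization: Adds the hypothesis ω(0) < ω(1), true of the best known bounds: for a constant ω (e.g. ω(σ) = 2.5, ρ = 0.8, μ = 1.7) the claim fails, since F' ≥ ω ≥ N for every σ. *)

theory Defs
  imports "HOL-Analysis.Analysis"
begin

text \<open>
  The cost model for matrix multiplication is the usual algebraic one: nonuniform straight-line
  programs over the rationals, whose length is the number of additions, subtractions and
  multiplications. Operands are entries of the two input matrices, rational constants, or results
  of earlier instructions.
\<close>

datatype operand = LeftEntry nat nat | RightEntry nat nat | Const rat | Res nat

datatype instr = Add operand operand | Sub operand operand | Mul operand operand

type_synonym mat = "nat \<Rightarrow> nat \<Rightarrow> rat"

fun operand_val :: "mat \<Rightarrow> mat \<Rightarrow> rat list \<Rightarrow> operand \<Rightarrow> rat" where
  "operand_val A B rs (LeftEntry i k) = A i k"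
| "operand_val A B rs (RightEntry k j) = B k j"
| "operand_val A B rs (Const c) = c"
| "operand_val A B rs (Res l) = (if l < length rs then rs ! l else 0)"

fun instr_val :: "mat \<Rightarrow> mat \<Rightarrow> rat list \<Rightarrow> instr \<Rightarrow> rat" where
  "instr_val A B rs (Add x y) = operand_val A B rs x + operand_val A B rs y"
| "instr_val A B rs (Sub x y) = operand_val A B rs x - operand_val A B rs y"
| "instr_val A B rs (Mul x y) = operand_val A B rs x * operand_val A B rs y"

definition run_prog :: "mat \<Rightarrow> mat \<Rightarrow> instr list \<Rightarrow> rat list" where
  "run_prog A B p = foldl (\<lambda>rs c. rs @ [instr_val A B rs c]) [] p"

text \<open>
  \<open>multiplies p a b c\<close>: the program \<open>p\<close> multiplies an \<open>a \<times> b\<close> by a \<open>b \<times> c\<close> matrix; \<open>out\<close> says where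
  each entry of the product is found. A program may mention entries outside these dimensions, but
  since it has to be correct for all values of such entries this is of no use to it.
\<close>

definition multiplies :: "instr list \<Rightarrow> nat \<Rightarrow> nat \<Rightarrow> nat \<Rightarrow> bool" where
  "multiplies p a b c \<longleftrightarrow>
     (\<exists>out. \<forall>A B. \<forall>i<a. \<forall>j<c.
        operand_val A B (run_prog A B p) (out i j) = (\<Sum>k<b. A i k * B k j))"

text \<open>
  The exponent of multiplying an \<open>n\<^sup>\<sigma> \<times> n\<close> by an \<open>n \<times> n\<close> matrix. It is taken in the extended reals
  only so that the infimum needs no side conditions.
\<close>

definition mm_exponent :: "real \<Rightarrow> ereal" where
  "mm_exponent \<sigma> =
     (INF \<tau> \<in> {\<tau>::real. \<exists>C::real. \<forall>n\<ge>1. \<exists>p.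
                multiplies p (nat \<lceil>real n powr \<sigma>\<rceil>) n n \<and>
                real (length p) \<le> C * real n powr \<tau>}. ereal \<tau>)"

text \<open>
  In the following, \<open>\<omega> :: real \<Rightarrow> real\<close> is a known upper bound on \<open>mm_exponent\<close>, relevant on
  \<open>[0,1]\<close> only.
\<close>

definition sigma' :: "(real \<Rightarrow> real) \<Rightarrow> real \<Rightarrow> real" where
  "sigma' \<omega> \<mu> = (THE \<sigma>. 0 < \<sigma> \<and> \<sigma> < 1 \<and> \<omega> \<sigma> = \<mu> + \<sigma>)"

definition F' :: "(real \<Rightarrow> real) \<Rightarrow> real \<Rightarrow> real \<Rightarrow> real" where
  "F' \<omega> \<sigma> \<rho> = max (\<omega> 1 * \<rho> + 1 - \<rho>) (\<omega> \<sigma>)"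

definition N :: "(real \<Rightarrow> real) \<Rightarrow> real \<Rightarrow> real \<Rightarrow> real" where
  "N \<omega> \<sigma> \<mu> = min (\<omega> 1) (\<mu> + \<sigma>)"

definition sigma'_thr :: "(real \<Rightarrow> real) \<Rightarrow> real \<Rightarrow> real \<Rightarrow> real" where
  "sigma'_thr \<omega> \<rho> \<mu> = max (sigma' \<omega> \<mu>) (\<rho> * (\<omega> 1 - 1) - (\<mu> - 1))"

end

theory Submission imports Defs "HOL-Real_Asymp.Real_Asymp" begin

text \<open>
  A correct program for the product of a row vector and an \<open>n \<times> n\<close> matrix has to read all \<open>n\<^sup>2\<close>
  entries of the matrix, so \<open>\<omega>(0) \<ge> 2 > \<mu>\<close>, while \<open>\<omega>(1) < \<mu> + 1\<close>. By convexity
  \<open>\<sigma> \<mapsto> \<omega>(\<sigma>) - \<mu> - \<sigma>\<close> therefore has exactly one zero in \<open>(0,1)\<close>, namely \<open>\<sigma>'\<^sub>\<mu>\<close>, and is negative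
  between it and 1. The other inequalities are linear, given
  \<open>\<omega>(\<sigma>) \<le> (1 - \<sigma>) \<omega>(0) + \<sigma> \<omega>(1)\<close> and \<open>\<omega>(1) > 1\<close>.
\<close>

subsection \<open>Reading the right matrix\<close>

text \<open>Syntactic occurrence over-approximates dependence, which is enough for a lower bound on
  length. The left matrix is not tracked, since the right one already forces quadratically many
  reads.\<close>

fun right_reads :: "operand \<Rightarrow> (nat \<times> nat) set" where
  "right_reads (RightEntry k j) = {(k, j)}"
| "right_reads _ = {}"

fun instr_right_reads :: "instr \<Rightarrow> (nat \<times> nat) set" where
  "instr_right_reads (Add x y) = right_reads x \<union> right_reads y"
| "instr_right_reads (Sub x y) = right_reads x \<union> right_reads y"
| "instr_right_reads (Mul x y) = right_reads x \<union> right_reads y"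

definition prog_right_reads :: "instr list \<Rightarrow> (nat \<times> nat) set" where
  "prog_right_reads p = (\<Union>c\<in>set p. instr_right_reads c)"

lemma finite_right_reads: "finite (right_reads x)"
  by (cases x) auto

lemma card_right_reads: "card (right_reads x) \<le> 1"
  by (cases x) auto

lemma finite_instr_right_reads: "finite (instr_right_reads c)"
  by (cases c) (auto simp: finite_right_reads)

lemma finite_prog_right_reads: "finite (prog_right_reads p)"
  by (auto simp: prog_right_reads_def finite_instr_right_reads)

lemma card_instr_right_reads: "card (instr_right_reads c) \<le> 2"
proof -
  have "card (right_reads x \<union> right_reads y) \<le> 2" for x y
    using card_Un_le[of "right_reads x" "right_reads y"] card_right_reads[of x]
      card_right_reads[of y] by linarith
  then show ?thesis by (cases c) auto
qed

lemma card_prog_right_reads: "card (prog_right_reads p) \<le> 2 * length p"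
proof (induction p)
  case Nil
  then show ?case by (simp add: prog_right_reads_def)
next
  case (Cons c p)
  have "prog_right_reads (c # p) = instr_right_reads c \<union> prog_right_reads p"
    by (simp add: prog_right_reads_def)
  then show ?case
    using card_Un_le[of "instr_right_reads c" "prog_right_reads p"] card_instr_right_reads[of c] Cons
    by simp
qed

lemma operand_val_cong:
  assumes "\<And>k j. (k, j) \<in> right_reads x \<Longrightarrow> B k j = B' k j"
  shows "operand_val A B rs x = operand_val A B' rs x"
  using assms by (cases x) auto

lemma instr_val_cong:
  assumes "\<And>k j. (k, j) \<in> instr_right_reads c \<Longrightarrow> B k j = B' k j"
  shows "instr_val A B rs c = instr_val A B' rs c"
  using assms by (cases c) (auto intro!: arg_cong2[where f="(+)"] arg_cong2[where f="(-)"]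
      arg_cong2[where f="(*)"] operand_val_cong)

lemma run_prog_cong:
  assumes "\<And>k j. (k, j) \<in> prog_right_reads p \<Longrightarrow> B k j = B' k j"
  shows "run_prog A B p = run_prog A B' p"
  unfolding run_prog_def
proof (rule foldl_cong)
  fix rs c assume "c \<in> set p"
  then have "instr_val A B rs c = instr_val A B' rs c"
    using assms by (intro instr_val_cong) (auto simp: prog_right_reads_def)
  then show "rs @ [instr_val A B rs c] = rs @ [instr_val A B' rs c]" by simp
qed auto

text \<open>An adversary argument: with an all-ones left matrix, changing the right one from zero to
  the unit matrix at \<open>(k, j)\<close> changes product entry \<open>(i, j)\<close> from 0 to 1.
  If neither the program nor the output operand mentions \<open>(k, j)\<close>, the computed value
  cannot change.\<close>

lemma multiplies_reads_right:
  assumes out: "\<And>A B i j. i < a \<Longrightarrow> j < c \<Longrightarrow>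
      operand_val A B (run_prog A B p) (out i j) = (\<Sum>k<b. A i k * B k j)"
    and "i < a" "k < b" "j < c"
  shows "(k, j) \<in> prog_right_reads p \<union> right_reads (out i j)"
proof (rule ccontr)
  assume unread: "\<not> ?thesis"
  define A :: mat where "A = (\<lambda>_ _. 1)"
  define B :: mat where "B = (\<lambda>_ _. 0)"
  define B' :: mat where "B' = (\<lambda>k' j'. if k' = k \<and> j' = j then 1 else 0)"
  have eq: "B k' j' = B' k' j'" if "(k', j') \<in> prog_right_reads p \<union> right_reads (out i j)" for k' j'
    using that unread by (auto simp: B_def B'_def)
  have "run_prog A B p = run_prog A B' p"
    using eq by (intro run_prog_cong) auto
  moreover have "operand_val A B rs (out i j) = operand_val A B' rs (out i j)" for rs
    using eq by (intro operand_val_cong) auto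
  ultimately have "(\<Sum>k<b. A i k * B k j) = (\<Sum>k<b. A i k * B' k j)"
    using out[OF assms(2,4), of A B] out[OF assms(2,4), of A B'] by simp
  moreover have "(\<Sum>k'<b. A i k' * B' k' j) = 1"
    using \<open>k < b\<close> by (simp add: A_def B'_def)
  ultimately show False
    by (simp add: B_def)
qed

text \<open>The summand \<open>c\<close> accounts for outputs that are themselves entries of the right matrix.\<close>

lemma multiplies_length:
  assumes "multiplies p a b c" "0 < a"
  shows "b * c \<le> 2 * length p + c"
proof -
  obtain out where out: "\<And>A B i j. i < a \<Longrightarrow> j < c \<Longrightarrow>
      operand_val A B (run_prog A B p) (out i j) = (\<Sum>k<b. A i k * B k j)"
    using assms(1) unfolding multiplies_def by metis
  \<comment> \<open>Row 0 of the product suffices: its entries together depend on the whole right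
    matrix.\<close>
  let ?O = "\<Union>j<c. right_reads (out 0 j)"
  have "{..<b} \<times> {..<c} \<subseteq> prog_right_reads p \<union> ?O"
    using multiplies_reads_right[OF out \<open>0 < a\<close>] by fast
  then have "card ({..<b} \<times> {..<c}) \<le> card (prog_right_reads p \<union> ?O)"
    by (intro card_mono) (auto simp: finite_prog_right_reads finite_right_reads)
  also have "\<dots> \<le> card (prog_right_reads p) + card ?O"
    by (rule card_Un_le)
  also have "card ?O \<le> (\<Sum>j<c. card (right_reads (out 0 j)))"
    by (rule card_UN_le) simp
  also have "\<dots> \<le> (\<Sum>j<c. 1)"
    by (intro sum_mono card_right_reads)
  finally show ?thesis
    using card_prog_right_reads[of p] by simp
qed

lemma mm_exponent_ge_2: "2 \<le> mm_exponent \<sigma>"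
  unfolding mm_exponent_def
proof (rule INF_greatest)
  fix \<tau> :: real
  assume "\<tau> \<in> {\<tau>. \<exists>C::real. \<forall>n\<ge>1. \<exists>p. multiplies p (nat \<lceil>real n powr \<sigma>\<rceil>) n n \<and>
                real (length p) \<le> C * real n powr \<tau>}"
  then obtain C :: real where C: "\<And>n. n \<ge> 1 \<Longrightarrow> \<exists>p. multiplies p (nat \<lceil>real n powr \<sigma>\<rceil>) n n \<and>
                real (length p) \<le> C * real n powr \<tau>"
    by blast
  have bound: "real n powr (2 - \<tau>) \<le> 4 * C" if "n \<ge> 2" for n
  proof -
    obtain p where p: "multiplies p (nat \<lceil>real n powr \<sigma>\<rceil>) n n"
      "real (length p) \<le> C * real n powr \<tau>"
      using C[of n] \<open>n \<ge> 2\<close> by auto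
    \<comment> \<open>The ceiling of a positive power is at least 1, so the left matrix has a row
      whatever the value of \<open>\<sigma>\<close>.\<close>
    have "0 < nat \<lceil>real n powr \<sigma>\<rceil>"
      using that by simp
    then have "n * n \<le> 2 * length p + n"
      using multiplies_length[OF p(1)] by blast
    then have "real n * real n \<le> 2 * real (length p) + real n"
      by (metis of_nat_add of_nat_le_iff of_nat_mult of_nat_numeral)
    \<comment> \<open>For \<open>n \<ge> 2\<close> the linear term is at most half of
      \<open>n * n\<close>; absorbing it turns the factor 2 into 4.\<close>
    moreover have "2 * real n \<le> real n * real n"
      using that by (intro mult_right_mono) auto
    ultimately have "real n * real n \<le> 4 * (C * real n powr \<tau>)"
      using p(2) by linarith
    then have "real n powr 2 \<le> 4 * C * real n powr \<tau>"
      using that by (simp add: power2_eq_square)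
    then show ?thesis
      using that by (simp add: powr_diff field_simps)
  qed
  have "2 \<le> \<tau>"
  proof (rule ccontr)
    assume "\<not> 2 \<le> \<tau>"
    then have "filterlim (\<lambda>n. real n powr (2 - \<tau>)) at_top sequentially"
      by real_asymp
    then have "eventually (\<lambda>n. 4 * C < real n powr (2 - \<tau>)) sequentially"
      by (simp add: filterlim_at_top_dense)
    moreover have "eventually (\<lambda>n. n \<ge> (2::nat)) sequentially"
      by (rule eventually_ge_at_top)
    ultimately have "eventually (\<lambda>n::nat. False) sequentially"
      by eventually_elim (use bound in fastforce)
    then show False by simp
  qed
  then show "2 \<le> ereal \<tau>"
    by simp
qed

subsection \<open>The threshold\<close>

text \<open>Here \<open>t\<close> is the convex combination of \<open>s\<close> and 1 with weights
  \<open>(1 - t) / (1 - s)\<close> and \<open>(t - s) / (1 - s)\<close>; the denominators are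
  cleared.\<close>

lemma convex_on_unit_bound:
  fixes f :: "real \<Rightarrow> real"
  assumes "convex_on {0..1} f" "0 \<le> s" "s < t" "t < 1"
  shows "(1 - s) * f t \<le> (1 - t) * f s + (t - s) * f 1"
proof -
  have "f ((1 - (t - s) / (1 - s)) *\<^sub>R s + ((t - s) / (1 - s)) *\<^sub>R 1)
      \<le> (1 - (t - s) / (1 - s)) * f s + (t - s) / (1 - s) * f 1"
    using assms by (intro convex_onD[OF assms(1)]) auto
  moreover have "(1 - (t - s) / (1 - s)) *\<^sub>R s + ((t - s) / (1 - s)) *\<^sub>R 1 = t"
    using assms by (simp add: divide_simps) (simp add: algebra_simps)
  ultimately have "f t \<le> (1 - (t - s) / (1 - s)) * f s + (t - s) / (1 - s) * f 1"
    by simp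
  then have "(1 - s) * f t \<le> (1 - s) * ((1 - (t - s) / (1 - s)) * f s + (t - s) / (1 - s) * f 1)"
    using assms by (intro mult_left_mono) auto
  also have "\<dots> = (1 - t) * f s + (t - s) * f 1"
    using assms by (simp add: divide_simps)
  finally show ?thesis .
qed

text \<open>The chord of \<open>f\<close> from \<open>s\<close> to 1 starts on the line and ends
  strictly below it. Hence it is strictly below the line at \<open>t\<close>, and \<open>f\<close>
  lies on or below the chord.\<close>

lemma below_line_after_crossing:
  fixes f :: "real \<Rightarrow> real"
  assumes "convex_on {0..1} f" "f 1 < \<mu> + 1" "0 \<le> s" "s < t" "t < 1" "f s = \<mu> + s"
  shows "f t < \<mu> + t"
proof -
  have "(1 - s) * f t \<le> (1 - t) * (\<mu> + s) + (t - s) * f 1"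
    using convex_on_unit_bound[OF assms(1,3-5)] assms(6) by simp
  also have "\<dots> < (1 - t) * (\<mu> + s) + (t - s) * (\<mu> + 1)"
    using assms by simp
  also have "\<dots> = (1 - s) * (\<mu> + t)"
    by (simp add: algebra_simps)
  finally show ?thesis
    using assms by simp
qed

lemma sigma'_crossing:
  assumes convex: "convex_on {0..1} \<omega>" and mono: "mono_on {0..1} \<omega>"
    and mu: "\<mu> < \<omega> 0" "\<omega> 1 - 1 < \<mu>"
  shows "0 < sigma' \<omega> \<mu> \<and> sigma' \<omega> \<mu> < 1 \<and> \<omega> (sigma' \<omega> \<mu>) = \<mu> + sigma' \<omega> \<mu>"
proof -
  have "\<exists>\<sigma>. 0 < \<sigma> \<and> \<sigma> < 1 \<and> \<omega> \<sigma> = \<mu> + \<sigma>"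
  proof -
    \<comment> \<open>\<open>\<omega>\<close> may jump at 1, so the intermediate value theorem is applied inside \<open>(0,1)\<close>.\<close>
    define a where "a = min 1 (\<omega> 0 - \<mu>) / 2"
    define b where "b = (1 + max a (\<omega> 1 - \<mu>)) / 2"
    \<comment> \<open>By monotonicity the last two inequalities give
      \<open>\<omega> b - b \<le> \<mu> \<le> \<omega> a - a\<close>, the sign change for the
      intermediate value theorem.\<close>
    have ab: "0 < a" "a < b" "b < 1" "a \<le> \<omega> 0 - \<mu>" "\<omega> 1 - \<mu> \<le> b"
      using mu by (auto simp: a_def b_def field_simps min_def max_def)
    have "continuous_on {0<..<1} \<omega>"
      by (rule convex_on_continuous) (auto intro: convex_on_subset[OF convex])
    then have "continuous_on {a..b} \<omega>"
      by (rule continuous_on_subset) (use ab in auto)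
    then have "continuous_on {a..b} (\<lambda>x. \<omega> x - x)"
      by (intro continuous_intros)
    moreover have "\<omega> 0 \<le> \<omega> a" "\<omega> b \<le> \<omega> 1"
      using ab by (auto intro!: mono_onD[OF mono])
    ultimately obtain x where "a \<le> x" "x \<le> b" "\<omega> x - x = \<mu>"
      using IVT2'[of "\<lambda>x. \<omega> x - x" b \<mu> a] ab by force
    then show ?thesis
      using ab by (intro exI[of _ x]) auto
  qed
  \<comment> \<open>Of two distinct crossings, the later one would lie strictly below the
    line.\<close>
  moreover have "s = t" if "0 < s \<and> s < 1 \<and> \<omega> s = \<mu> + s" "0 < t \<and> t < 1 \<and> \<omega> t = \<mu> + t" for s t
    using that below_line_after_crossing[OF convex, of \<mu> s t]
      below_line_after_crossing[OF convex, of \<mu> t s] mu by (cases s t rule: linorder_cases) auto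
  ultimately have "\<exists>!\<sigma>. 0 < \<sigma> \<and> \<sigma> < 1 \<and> \<omega> \<sigma> = \<mu> + \<sigma>"
    by blast
  then show ?thesis
    unfolding sigma'_def by (rule theI')
qed

theorem theorem7p7:
  fixes \<omega> :: "real \<Rightarrow> real" and \<rho> \<mu> :: real
  assumes upper_bound: "\<And>\<sigma>. 0 \<le> \<sigma> \<Longrightarrow> \<sigma> \<le> 1 \<Longrightarrow> mm_exponent \<sigma> \<le> ereal (\<omega> \<sigma>)"
    and convex: "convex_on {0..1} \<omega>"
    and nondecreasing: "mono_on {0..1} \<omega>"
    and nonconstant: "\<omega> 0 < \<omega> 1"
    and rho: "0 < \<rho>" "\<rho> < 1"
    and mu: "\<mu> \<le> 1 + \<rho>" "\<omega> 1 - 1 < \<mu>"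
  shows "{sigma'_thr \<omega> \<rho> \<mu> <..< 1} \<noteq> {} \<and>
         (\<forall>\<sigma> \<in> {sigma'_thr \<omega> \<rho> \<mu> <..< 1}. F' \<omega> \<sigma> \<rho> < N \<omega> \<sigma> \<mu>)"
proof -
  have "2 \<le> ereal (\<omega> 0)"
    using order_trans[OF mm_exponent_ge_2[of 0] upper_bound[of 0]] by simp
  then have omega0: "2 \<le> \<omega> 0"
    by simp
  then have cross: "0 < sigma' \<omega> \<mu>" "sigma' \<omega> \<mu> < 1" "\<omega> (sigma' \<omega> \<mu>) = \<mu> + sigma' \<omega> \<mu>"
    using sigma'_crossing[OF convex nondecreasing, of \<mu>] mu rho by auto
  \<comment> \<open>With \<open>\<omega> 1 - 1 < \<mu>\<close> this puts the second term of the
    threshold below 1; rearranged, it also bounds the first term of \<open>F'\<close> by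
    \<open>\<omega> 1\<close>.\<close>
  have gap: "\<rho> * (\<omega> 1 - 1) < \<omega> 1 - 1"
    using omega0 nonconstant rho by simp
  have "sigma'_thr \<omega> \<rho> \<mu> < 1"
    using cross gap mu by (simp add: sigma'_thr_def)
  then have "{sigma'_thr \<omega> \<rho> \<mu> <..< 1} \<noteq> {}"
    by simp
  moreover have "F' \<omega> \<sigma> \<rho> < N \<omega> \<sigma> \<mu>" if "\<sigma> \<in> {sigma'_thr \<omega> \<rho> \<mu> <..< 1}" for \<sigma>
  proof -
    have \<sigma>: "sigma' \<omega> \<mu> < \<sigma>" "\<rho> * (\<omega> 1 - 1) - (\<mu> - 1) < \<sigma>" "\<sigma> < 1"
      using that by (auto simp: sigma'_thr_def)
    have "\<omega> \<sigma> < \<mu> + \<sigma>"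
      using below_line_after_crossing[OF convex, of \<mu> "sigma' \<omega> \<mu>" \<sigma>] cross \<sigma> mu by simp
    \<comment> \<open>Monotonicity gives only a weak inequality; strictness comes from the chord
      between 0 and 1, which has positive slope.\<close>
    moreover have "\<omega> \<sigma> < \<omega> 1"
    proof -
      have "\<omega> \<sigma> \<le> (1 - \<sigma>) * \<omega> 0 + \<sigma> * \<omega> 1"
        using convex_on_unit_bound[OF convex, of 0 \<sigma>] cross \<sigma> by simp
      also have "\<dots> < (1 - \<sigma>) * \<omega> 1 + \<sigma> * \<omega> 1"
        using nonconstant \<sigma> by simp
      finally show ?thesis
        by (simp add: algebra_simps)
    qed
    \<comment> \<open>The second inequality is the condition that \<open>\<sigma>\<close> exceeds
      the second term of the threshold, rearranged.\<close>
    moreover have "\<omega> 1 * \<rho> + 1 - \<rho> < \<omega> 1" "\<omega> 1 * \<rho> + 1 - \<rho> < \<mu> + \<sigma>"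
      using gap \<sigma> by (auto simp: algebra_simps)
    ultimately show ?thesis
      by (simp add: F'_def N_def)
  qed
  ultimately show ?thesis
    by blast
qed

end
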